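(* Let $1<p<\infty$, let $w,\sigma$ be two weights on $\mathbb{R}^d$, and let $\mathscr{L}\subset\mathscr{D}$ be a sparse family of dyadic cubes. Then for every dyadic cube $Q\in\mathscr{D}$, $$\int_Q\Big(\sum_{\substack{L\in\mathscr{L}\\ L\subseteq Q}}\langle\sigma\rangle_L 1_L\Big)^p w\,\mathrm{d}x\leq C\,[w,\sigma]_{A_p}[\sigma]_{A_\infty}\,\sigma(Q),$$ where the constant $C$ depends only on $p$, the dimension $d$ and the sparseness constant of $\mathscr{L}$.
   Context: A weight is a locally integrable, almost everywhere positive function on $\mathbb{R}^d$; $\sigma(Q):=\int_Q\sigma$. $\mathscr{D}$ is the collection of dyadic cubes in $\mathbb{R}^d$. $|Q|$ is the Lebesgue measure of $Q$, and $\langle f\rangle_Q:=|Q|^{-1}\int_Q f\,\mathrm{d}x$. A family $\mathscr{L}\subset\mathscr{D}$ is sparse with constant $c>0$ if there are pairwise disjoint measurable subsets $E(L)\subset L$, $L\in\mathscr{L}$, with $|E(L)|\geq c|L|$ for all $L\in\mathscr{L}$. The two-weight $A_p$ constant is $$[w,\sigma]_{A_p}:=\sup_Q\langle w\rangle_Q\langle\sigma\rangle_Q^{p-1},$$ and the $A_\infty$ constant is $$[\sigma]_{A_\infty}:=\sup_Q\frac{1}{\sigma(Q)}\int_Q M(1_Q\sigma)\,\mathrm{d}x,$$ with suprema over all cubes $Q\subset\mathbb{R}^d$, where $M$ is the Hardy–Littlewood maximal operator $Mf(x)=\sup_{Q\ni x}\langle|f|\rangle_Q$. *)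

theory Defs
  imports "HOL-Analysis.Analysis"
begin

text \<open>
  Dyadic cubes are half-open, so that the cubes of one generation partition space. General cubes
  are half-open as well, so that dyadic cubes are cubes. For the suprema below this is immaterial:
  half-open, open and closed axis-parallel cubes yield the same values.
\<close>

definition hcube :: "real ^ 'n \<Rightarrow> real \<Rightarrow> (real ^ 'n) set" where
  "hcube a l = {x. \<forall>i. a $ i \<le> x $ i \<and> x $ i < a $ i + l}"

definition cubes :: "(real ^ 'n) set set" where
  "cubes = {hcube a l | a l. 0 < l}"

definition dyadic_cubes :: "(real ^ 'n) set set" where
  "dyadic_cubes = {hcube (\<chi> i. 2 powi k * of_int (m i)) (2 powi k) | (k :: int) (m :: 'n \<Rightarrow> int). True}"

definition locally_integrable :: "(real ^ 'n \<Rightarrow> real) \<Rightarrow> bool" where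
  "locally_integrable f \<longleftrightarrow> (\<forall>K. compact K \<longrightarrow> set_integrable lebesgue K f)"

definition weight :: "(real ^ 'n \<Rightarrow> real) \<Rightarrow> bool" where
  "weight w \<longleftrightarrow> locally_integrable w \<and> (AE x in lebesgue. 0 < w x)"

text \<open>
  All integrands in the statement are nonnegative almost everywhere, so integrals, averages and
  suprema are taken in \<open>[0, \<infinity>]\<close>. In particular the two weight constants may be infinite.
\<close>

definition weight_mass :: "(real ^ 'n \<Rightarrow> real) \<Rightarrow> (real ^ 'n) set \<Rightarrow> ennreal" where
  "weight_mass \<sigma> Q = (\<integral>\<^sup>+x\<in>Q. ennreal (\<sigma> x) \<partial>lebesgue)"

definition cube_avg :: "(real ^ 'n \<Rightarrow> ennreal) \<Rightarrow> (real ^ 'n) set \<Rightarrow> ennreal" where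
  "cube_avg f Q = (\<integral>\<^sup>+x\<in>Q. f x \<partial>lebesgue) / emeasure lebesgue Q"

definition HL_maximal :: "(real ^ 'n \<Rightarrow> real) \<Rightarrow> real ^ 'n \<Rightarrow> ennreal" where
  "HL_maximal f x = (SUP Q \<in> {Q \<in> cubes. x \<in> Q}. cube_avg (\<lambda>y. ennreal \<bar>f y\<bar>) Q)"

text \<open>Real powers on \<open>[0, \<infinity>]\<close>; only meaningful for exponents \<open>t > 0\<close>, where \<open>\<infinity>\<close> to the \<open>t\<close> is \<open>\<infinity>\<close>.\<close>

definition ennreal_powr :: "ennreal \<Rightarrow> real \<Rightarrow> ennreal" where
  "ennreal_powr x t = (if x = \<infinity> then \<infinity> else ennreal (enn2real x powr t))"

definition Ap_const :: "real \<Rightarrow> (real ^ 'n \<Rightarrow> real) \<Rightarrow> (real ^ 'n \<Rightarrow> real) \<Rightarrow> ennreal" where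
  "Ap_const p w \<sigma> =
     (SUP Q \<in> cubes. cube_avg (\<lambda>x. ennreal (w x)) Q
                      * ennreal_powr (cube_avg (\<lambda>x. ennreal (\<sigma> x)) Q) (p - 1))"

definition Ainf_const :: "(real ^ 'n \<Rightarrow> real) \<Rightarrow> ennreal" where
  "Ainf_const \<sigma> =
     (SUP Q \<in> cubes. (\<integral>\<^sup>+x\<in>Q. HL_maximal (\<lambda>y. indicator Q y * \<sigma> y) x \<partial>lebesgue) / weight_mass \<sigma> Q)"

definition sparse_family :: "real \<Rightarrow> (real ^ 'n) set set \<Rightarrow> bool" where
  "sparse_family c \<L> \<longleftrightarrow> \<L> \<subseteq> dyadic_cubes \<and>
     (\<exists>E. (\<forall>L\<in>\<L>. E L \<subseteq> L \<and> E L \<in> sets lebesgue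
               \<and> ennreal c * emeasure lebesgue L \<le> emeasure lebesgue (E L))
        \<and> disjoint_family_on E \<L>)"

end

theory Submission
  imports Defs
begin

text \<open>
  Write \<open>b L\<close> and \<open>a L\<close> for the averages of \<open>w\<close> and \<open>\<sigma>\<close> over \<open>L\<close>, put
  \<open>r = 1 / (p - 1)\<close>, and let \<open>A\<close> be the two-weight constant, so that
  \<open>a L \<le> A powr r * b L powr (-r)\<close>. The cubes of the family that contain a point form a chain, and
  convexity of the power gives, along a chain and for \<open>s \<ge> 1\<close>,
  \[
    \Bigl(\sum_L a_L\Bigr)^s \le s \sum_L a_L \Bigl(\sum_{L' \subseteq L} a_{L'}\Bigr)^{s-1}.
  \]
  Integrating this against \<open>w\<close> trades the exponent \<open>s\<close> for \<open>s - 1\<close> at the cost of localising the inner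
  sum to \<open>L\<close>. Taking \<open>s = p\<close> reduces the estimate to the local bound
  \[
    \int \Bigl(\sum_{L' \subseteq L} a_{L'} 1_{L'}\Bigr)^{s} w
      \le C\, A^{r s}\, b_L^{1 - r s}\, |L|
  \]
  for the single exponent \<open>s = p - 1\<close>, where it reads \<open>C * A * |L|\<close>: this leaves
  \<open>C * A\<close> times the sum of the masses \<open>\<sigma>(L)\<close>, which sparseness and the maximal function bound by
  \<open>[\<sigma>] * \<sigma>(Q) / c\<close> with the \<open>A\<^sub>\<infinity>\<close> constant of \<open>\<sigma>\<close>.

  The local bound (\<open>local_testing\<close>) holds for all \<open>0 < s \<le> p - 1\<close> and is proved by lowering
  \<open>s\<close> in unit steps with the same chain inequality until \<open>s \<le> 1\<close>, where
  \<open>(\<Sum> a) powr s \<le> \<Sum> a powr s\<close> takes over. In both cases the \<open>A\<^sub>p\<close> condition turns the integrand into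
  powers of \<open>b\<close>, and what remains is a Kolmogorov inequality
  (\<open>kolmogorov_inequality\<close>): for \<open>0 \<le> \<theta> < 1\<close>,
  \[
    \sum_{L' \subseteq L} b_{L'}^{\theta}\, |L'| \le K\, b_L^{\theta}\, |L|,
  \]
  which follows from sparseness and the weak-type estimate for the maximal function of the family.

  All of this is done for finite families, where the only geometric input is that two sets are nested or
  disjoint; monotone convergence passes to infinite ones.
\<close>

section \<open>Powers of sums along chains\<close>

text \<open>
  The tangent to the power function at \<open>x + y\<close> lies below its graph.
\<close>

lemma powr_add_le_tangent:
  fixes x y s :: real
  assumes "0 \<le> x" "0 \<le> y" "1 \<le> s"
  shows "(x + y) powr s \<le> x powr s + s * y * (x + y) powr (s - 1)"
proof (cases "x = 0 \<or> y = 0")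
  case True
  then show ?thesis
  proof
    assume "x = 0"
    have "y powr s = y * y powr (s - 1)"
      using assms by (cases "y = 0") (auto simp: powr_diff)
    moreover have "1 * (y * y powr (s - 1)) \<le> s * (y * y powr (s - 1))"
      using assms by (intro mult_right_mono) auto
    ultimately show ?thesis using \<open>x = 0\<close> by (simp add: mult.assoc)
  qed auto
next
  case False
  then have pos: "0 < x" "0 < y" using assms by auto
  have "\<exists>z. x < z \<and> z < x + y \<and>
      (x + y) powr s - x powr s = (x + y - x) * (s * z powr (s - 1))"
    using pos by (intro MVT2) (auto intro!: derivative_eq_intros)
  then obtain z where z: "x < z" "z < x + y"
    "(x + y) powr s - x powr s = y * (s * z powr (s - 1))" by auto
  have "y * (s * z powr (s - 1)) \<le> y * (s * (x + y) powr (s - 1))"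
    using assms z pos by (intro mult_left_mono powr_mono2) auto
  with z show ?thesis by (simp add: mult_ac)
qed

text \<open>
  Adding the sets of the chain in increasing order, each step raises the power of the partial sum by at
  most the tangent term, and the partial sum at \<open>L\<close> is the sum over the sets contained in \<open>L\<close>.
\<close>

lemma chain_sum_powr_le:
  fixes a :: "'a set \<Rightarrow> real" and s :: real
  assumes "finite C" "\<And>L L'. L \<in> C \<Longrightarrow> L' \<in> C \<Longrightarrow> L \<subseteq> L' \<or> L' \<subseteq> L"
    and "\<And>L. L \<in> C \<Longrightarrow> 0 \<le> a L" "1 \<le> s"
  shows "(\<Sum>L\<in>C. a L) powr s \<le> s * (\<Sum>L\<in>C. a L * (\<Sum>L'\<in>{L'\<in>C. L' \<subseteq> L}. a L') powr (s - 1))"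
  using assms
proof (induction C rule: finite_psubset_induct)
  case (psubset C)
  show ?case
  proof (cases "C = {}")
    case False
    then obtain M where M: "M \<in> C" and max: "\<And>L. L \<in> C \<Longrightarrow> M \<subseteq> L \<Longrightarrow> L = M"
      using finite_has_maximal[of C] psubset.hyps by auto
    define D where "D = C - {M}"
    have C: "C = insert M D" "M \<notin> D" "finite D" "D \<subset> C"
      using M psubset.hyps by (auto simp: D_def)
    have top: "{L'\<in>C. L' \<subseteq> M} = C" using M max psubset.prems(1) by blast
    have low: "{L'\<in>C. L' \<subseteq> L} = {L'\<in>D. L' \<subseteq> L}" if "L \<in> D" for L
      using that max C by auto
    have IH: "(\<Sum>L\<in>D. a L) powr s \<le> s * (\<Sum>L\<in>D. a L * (\<Sum>L'\<in>{L'\<in>D. L' \<subseteq> L}. a L') powr (s - 1))"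
      using C(4) psubset.prems by (intro psubset.IH) auto
    have "(\<Sum>L\<in>C. a L) powr s = ((\<Sum>L\<in>D. a L) + a M) powr s"
      using C by (simp add: add.commute)
    also have "\<dots> \<le> (\<Sum>L\<in>D. a L) powr s + s * a M * ((\<Sum>L\<in>D. a L) + a M) powr (s - 1)"
      using C psubset.prems M by (intro powr_add_le_tangent sum_nonneg) auto
    also have "(\<Sum>L\<in>D. a L) + a M = (\<Sum>L'\<in>{L'\<in>C. L' \<subseteq> M}. a L')"
      using C top by (simp add: add.commute)
    also have "(\<Sum>L\<in>D. a L) powr s + s * a M * (\<Sum>L'\<in>{L'\<in>C. L' \<subseteq> M}. a L') powr (s - 1)
        \<le> s * (\<Sum>L\<in>D. a L * (\<Sum>L'\<in>{L'\<in>C. L' \<subseteq> L}. a L') powr (s - 1))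
          + s * a M * (\<Sum>L'\<in>{L'\<in>C. L' \<subseteq> M}. a L') powr (s - 1)"
      using IH low by simp
    also have "\<dots> = s * (\<Sum>L\<in>insert M D. a L * (\<Sum>L'\<in>{L'\<in>C. L' \<subseteq> L}. a L') powr (s - 1))"
      using C(2,3) by (simp add: algebra_simps)
    finally show ?thesis using C(1) by simp
  qed simp
qed

lemma sum_powr_le_powr_sum:
  fixes a :: "'a \<Rightarrow> real" and s :: real
  assumes "finite C" "\<And>L. L \<in> C \<Longrightarrow> 0 \<le> a L" "0 < s" "s \<le> 1"
  shows "(\<Sum>L\<in>C. a L) powr s \<le> (\<Sum>L\<in>C. a L powr s)"
  using assms
proof (induction C rule: finite_induct)
  case (insert x C)
  \<comment> \<open>Normalise to \<open>u / t + v / t = 1\<close>: on \<open>[0, 1]\<close> the power \<open>s \<le> 1\<close> dominates the identity.\<close>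
  have two: "(u + v) powr s \<le> u powr s + v powr s" if "0 \<le> u" "0 \<le> v" for u v :: real
  proof (cases "u + v = 0")
    case False
    define t where "t = u + v"
    have t: "0 < t" using that False by (simp add: t_def)
    have *: "z / t \<le> (z / t) powr s" if "0 \<le> z" "z \<le> t" for z
      using powr_mono'[of s 1 "z / t"] that t insert.prems by auto
    have "1 = u / t + v / t" using t by (simp add: t_def add_divide_distrib[symmetric])
    also have "\<dots> \<le> (u / t) powr s + (v / t) powr s"
      using that by (intro add_mono *) (auto simp: t_def)
    also have "\<dots> = (u powr s + v powr s) / t powr s"
      using that t by (simp add: powr_divide add_divide_distrib)
    finally show ?thesis using t by (simp add: t_def field_simps)
  qed (use that in auto)
  have "(\<Sum>L\<in>insert x C. a L) powr s = (a x + (\<Sum>L\<in>C. a L)) powr s" using insert by simp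
  also have "\<dots> \<le> a x powr s + (\<Sum>L\<in>C. a L) powr s"
    using insert by (intro two sum_nonneg) auto
  finally show ?case using insert by simp
qed simp

text \<open>
  A discrete layer-cake formula: the top level below \<open>v\<close> already dominates \<open>v powr \<theta>\<close>, and the term
  \<open>T powr \<theta>\<close> covers the case that \<open>v\<close> lies below all levels.
\<close>

lemma powr_le_sum_dyadic_levels:
  fixes v T \<theta> :: real
  assumes "0 < T" "0 < v" "0 \<le> \<theta>" "v \<le> 2 ^ N * T"
  shows "v powr \<theta> \<le> T powr \<theta> + (\<Sum>k<N. if 2 ^ k * T < v then (2 ^ Suc k * T) powr \<theta> else 0)"
  using assms(4)
proof (induction N)
  case 0
  then show ?case using assms by (auto intro!: powr_mono2)
next
  case (Suc N)
  show ?case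
  proof (cases "v \<le> 2 ^ N * T")
    case True
    with Suc.IH show ?thesis using assms by auto
  next
    case False
    have "v powr \<theta> \<le> (2 ^ Suc N * T) powr \<theta>"
      using Suc.prems assms by (intro powr_mono2) auto
    moreover have "0 \<le> (\<Sum>k<N. if 2 ^ k * T < v then (2 ^ Suc k * T) powr \<theta> else 0)"
      by (intro sum_nonneg) auto
    ultimately show ?thesis using False powr_ge_zero[of T \<theta>] by (simp add: add_increasing)
  qed
qed

section \<open>Finite sparse families\<close>

text \<open>
  The two measures are Lebesgue measure and \<open>w dx\<close>. Of the geometry of dyadic cubes only nestedness is
  kept; positivity of the masses makes negative powers of averages meaningful.
\<close>

locale sparse_laminar =
  fixes \<mu> \<nu> :: "'a measure" and F :: "'a set set" and c :: real
  assumes finite_F: "finite F"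
    and c_pos: "0 < c"
    and laminar: "\<And>L L'. L \<in> F \<Longrightarrow> L' \<in> F \<Longrightarrow> L \<subseteq> L' \<or> L' \<subseteq> L \<or> L \<inter> L' = {}"
    and sets_eq: "sets \<nu> = sets \<mu>"
    and sets_F: "\<And>L. L \<in> F \<Longrightarrow> L \<in> sets \<mu>"
    and finite_mass: "\<And>L. L \<in> F \<Longrightarrow> emeasure \<mu> L \<noteq> \<infinity>" "\<And>L. L \<in> F \<Longrightarrow> emeasure \<nu> L \<noteq> \<infinity>"
    and pos_mass: "\<And>L. L \<in> F \<Longrightarrow> 0 < measure \<mu> L" "\<And>L. L \<in> F \<Longrightarrow> 0 < measure \<nu> L"
    and sparse: "\<exists>E. (\<forall>L\<in>F. E L \<subseteq> L \<and> E L \<in> sets \<mu> \<and> c * measure \<mu> L \<le> measure \<mu> (E L))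
                   \<and> disjoint_family_on E F"
begin

definition avg :: "'a set \<Rightarrow> real" where
  "avg L = measure \<nu> L / measure \<mu> L"

definition below :: "'a set \<Rightarrow> 'a set set" where
  "below L = {L' \<in> F. L' \<subseteq> L}"

lemma belowD: "L' \<in> below L \<Longrightarrow> L' \<in> F" "L' \<in> below L \<Longrightarrow> L' \<subseteq> L"
  by (auto simp: below_def)

lemma finite_below [simp]: "finite (below L)"
  using finite_F by (simp add: below_def)

lemma avg_pos: "L \<in> F \<Longrightarrow> 0 < avg L"
  using pos_mass by (simp add: avg_def)

lemma Union_in_fmeasurable: "G \<subseteq> F \<Longrightarrow> \<Union>G \<in> fmeasurable \<mu>"
  using finite_F sets_F finite_mass
  by (intro fmeasurable.finite_Union) (auto dest: finite_subset simp: fmeasurable_def top.not_eq_extremum)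

lemma carleson_packing:
  assumes "G \<subseteq> F"
  shows "c * (\<Sum>L\<in>G. measure \<mu> L) \<le> measure \<mu> (\<Union>G)"
proof -
  obtain E where E: "\<And>L. L \<in> F \<Longrightarrow> E L \<subseteq> L \<and> E L \<in> sets \<mu> \<and> c * measure \<mu> L \<le> measure \<mu> (E L)"
    and disj: "disjoint_family_on E F" using sparse by auto
  have fG: "finite G" using assms finite_F finite_subset by auto
  have Efin: "emeasure \<mu> (E L) \<noteq> \<infinity>" if "L \<in> G" for L
  proof -
    have "emeasure \<mu> (E L) \<le> emeasure \<mu> L"
      using that assms E sets_F by (intro emeasure_mono) auto
    moreover have "emeasure \<mu> L \<noteq> \<infinity>" using that assms finite_mass by auto
    ultimately show ?thesis by (metis infinity_ennreal_def neq_top_trans)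
  qed
  have "c * (\<Sum>L\<in>G. measure \<mu> L) \<le> (\<Sum>L\<in>G. measure \<mu> (E L))"
    unfolding sum_distrib_left using E assms by (intro sum_mono) auto
  also have "\<dots> = measure \<mu> (\<Union>L\<in>G. E L)"
    using fG Efin E assms disjoint_family_on_mono[OF assms disj]
    by (intro measure_finite_Union[symmetric]) auto
  also have "\<dots> \<le> measure \<mu> (\<Union>G)"
    using E assms fG Union_in_fmeasurable[OF assms]
    by (intro measure_mono_fmeasurable sets.finite_UN) blast+
  finally show ?thesis .
qed

text \<open>
  The weak-type bound for the maximal operator of the family, with constant one: nestedness makes the
  maximal members of \<open>G\<close> a disjoint cover of its union.
\<close>

lemma weak_type:
  assumes "G \<subseteq> below X" "X \<in> F" "0 \<le> t"
    and dens: "\<And>L. L \<in> G \<Longrightarrow> t * measure \<mu> L \<le> measure \<nu> L"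
  shows "t * measure \<mu> (\<Union>G) \<le> measure \<nu> X"
proof -
  have GF: "G \<subseteq> F" using assms(1) by (auto simp: below_def)
  then have fG: "finite G" using finite_F finite_subset by auto
  define H where "H = {L \<in> G. \<forall>L'\<in>G. L \<subseteq> L' \<longrightarrow> L' = L}"
  have HG: "H \<subseteq> G" and HF: "H \<subseteq> F" and fH: "finite H" using fG GF by (auto simp: H_def)
  have "\<exists>M\<in>H. L \<subseteq> M" if "L \<in> G" for L
    using finite_has_maximal2[OF fG that] by (auto simp: H_def)
  then have "\<Union>G = \<Union>H" using HG by blast
  have disj: "disjoint_family_on (\<lambda>L. L) H"
    unfolding disjoint_family_on_def
  proof (intro ballI impI)
    fix L L' assume L: "L \<in> H" "L' \<in> H" "L \<noteq> L'"
    then have "\<not> L \<subseteq> L'" "\<not> L' \<subseteq> L" by (auto simp: H_def)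
    with laminar[of L L'] L HF show "L \<inter> L' = {}" by blast
  qed
  have "t * measure \<mu> (\<Union>G) = t * (\<Sum>L\<in>H. measure \<mu> L)"
    unfolding \<open>\<Union>G = \<Union>H\<close>
    using measure_finite_Union[OF fH _ disj, of \<mu>] HF sets_F finite_mass by (auto simp: subset_eq)
  also have "\<dots> \<le> (\<Sum>L\<in>H. measure \<nu> L)"
    unfolding sum_distrib_left using dens HG by (intro sum_mono) auto
  also have "\<dots> = measure \<nu> (\<Union>H)"
    using measure_finite_Union[OF fH _ disj, of \<nu>] HF sets_F sets_eq finite_mass
    by (auto simp: subset_eq)
  also have "\<dots> \<le> measure \<nu> X"
    using HG assms(1,2) HF fH sets_F sets_eq finite_mass(2)
    by (intro measure_mono_fmeasurable sets.finite_Union)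
       (auto simp: fmeasurable_def top.not_eq_extremum below_def)
  finally show ?thesis .
qed

end

text \<open>
  The factor \<open>1 / c\<close> comes from the packing condition, the \<open>1\<close> from the cubes whose average does not
  exceed that of the top cube, and the rest is the geometric series over the dyadic levels above it.
\<close>

definition kolmogorov_const :: "real \<Rightarrow> real \<Rightarrow> real" where
  "kolmogorov_const c \<theta> = (1 + 2 powr \<theta> / (1 - 2 powr (\<theta> - 1))) / c"

lemma two_powr_less_one: "\<theta> < 1 \<Longrightarrow> 2 powr (\<theta> - 1) < (1::real)"
  using powr_less_mono[of "\<theta> - 1" 0 2] by simp

lemma kolmogorov_const_pos: "0 < c \<Longrightarrow> \<theta> < 1 \<Longrightarrow> 0 < kolmogorov_const c \<theta>"
  using two_powr_less_one[of \<theta>] unfolding kolmogorov_const_def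
  by (intro divide_pos_pos add_pos_nonneg) auto

text \<open>
  The members whose average exceeds \<open>2 ^ k * avg X\<close> fill, by the weak-type estimate, at most a fraction
  \<open>2 powr (- k)\<close> of \<open>X\<close>, and by packing the sum of their measures is comparable to that. Level \<open>k\<close>
  therefore contributes at most a multiple of \<open>2 powr (k * (\<theta> - 1))\<close>, which is summable exactly because
  \<open>\<theta> < 1\<close>.
\<close>

lemma (in sparse_laminar) kolmogorov_inequality:
  assumes "0 \<le> \<theta>" "\<theta> < 1" "X \<in> F"
  shows "(\<Sum>L\<in>below X. avg L powr \<theta> * measure \<mu> L)
           \<le> kolmogorov_const c \<theta> * (avg X powr \<theta> * measure \<mu> X)"
proof -
  define T where "T = avg X"
  define m where "m = measure \<mu>"
  have T: "0 < T" using avg_pos assms by (simp add: T_def)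
  have m: "0 < m L" if "L \<in> F" for L using that pos_mass by (simp add: m_def)
  have car: "(\<Sum>L\<in>G. m L) \<le> measure \<mu> (\<Union>G) / c" if "G \<subseteq> below X" for G
    using carleson_packing[of G] that belowD c_pos by (auto simp: field_simps m_def subset_eq)
  have all: "(\<Sum>L\<in>below X. m L) \<le> m X / c"
  proof -
    have "\<Union>(below X) = X" using assms by (auto simp: below_def)
    then show ?thesis using car[of "below X"] by (simp add: m_def)
  qed
  have level: "(\<Sum>L\<in>{L\<in>below X. 2 ^ k * T < avg L}. m L) \<le> m X / 2 ^ k / c" for k
  proof -
    let ?G = "{L\<in>below X. 2 ^ k * T < avg L}"
    have "2 ^ k * T * measure \<mu> (\<Union>?G) \<le> measure \<nu> X"
    proof (rule weak_type)
      fix L assume L: "L \<in> ?G"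
      then have "0 < measure \<mu> L" using pos_mass belowD by auto
      with L show "2 ^ k * T * measure \<mu> L \<le> measure \<nu> L" by (simp add: avg_def field_simps)
    qed (use T assms in auto)
    also have "measure \<nu> X = T * m X" using pos_mass(1)[OF assms(3)] by (simp add: T_def avg_def m_def)
    finally have "measure \<mu> (\<Union>?G) \<le> m X / 2 ^ k" using T by (simp add: field_simps)
    then show ?thesis using car[of ?G] c_pos
      by (smt (verit) divide_right_mono mem_Collect_eq subsetI)
  qed
  \<comment> \<open>Finitely many averages occur, so finitely many levels suffice.\<close>
  obtain N :: nat where N: "\<And>L. L \<in> below X \<Longrightarrow> avg L \<le> 2 ^ N * T"
  proof -
    obtain B where B: "\<And>L. L \<in> below X \<Longrightarrow> avg L \<le> B"
      using finite_imp_Sup_less[of "avg ` below X"] bdd_above_finite[of "avg ` below X"]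
      by (auto simp: bdd_above_def)
    obtain N :: nat where "B / T < 2 ^ N" using real_arch_pow[of 2 "B / T"] by auto
    then have "B \<le> 2 ^ N * T" using T by (simp add: field_simps)
    with B show ?thesis by (intro that[of N]) force
  qed
  define q where "q = 2 powr (\<theta> - 1)"
  have q: "0 < q" "q < 1" using two_powr_less_one assms by (auto simp: q_def)
  have coef: "(2 ^ Suc k * T) powr \<theta> * (m X / 2 ^ k / c) = T powr \<theta> * m X / c * (2 powr \<theta> * q ^ k)" for k
  proof -
    have "(2 ^ Suc k * T) powr \<theta> = 2 powr \<theta> * (2 powr \<theta>) ^ k * T powr \<theta>"
      using T by (simp add: powr_mult powr_power powr_realpow[symmetric] powr_powr mult.commute)
    moreover have "q ^ k = (2 powr \<theta>) ^ k / 2 ^ k"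
      by (simp add: q_def powr_diff power_divide)
    ultimately show ?thesis by (simp add: mult_ac)
  qed
  have split: "(if 2 ^ k * T < avg L then (2 ^ Suc k * T) powr \<theta> else 0) * m L
      = (2 ^ Suc k * T) powr \<theta> * (if 2 ^ k * T < avg L then m L else 0)" for k L
    by simp
  have "(\<Sum>L\<in>below X. avg L powr \<theta> * m L)
      \<le> (\<Sum>L\<in>below X. (T powr \<theta> + (\<Sum>k<N. if 2 ^ k * T < avg L then (2 ^ Suc k * T) powr \<theta> else 0)) * m L)"
    using T avg_pos assms N m belowD
    by (intro sum_mono mult_right_mono powr_le_sum_dyadic_levels) (auto simp: less_imp_le)
  also have "\<dots> = T powr \<theta> * (\<Sum>L\<in>below X. m L)
      + (\<Sum>L\<in>below X. \<Sum>k<N. (2 ^ Suc k * T) powr \<theta> * (if 2 ^ k * T < avg L then m L else 0))"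
    unfolding distrib_right sum.distrib sum_distrib_right split sum_distrib_left ..
  also have "\<dots> = T powr \<theta> * (\<Sum>L\<in>below X. m L)
      + (\<Sum>k<N. (2 ^ Suc k * T) powr \<theta> * (\<Sum>L\<in>{L\<in>below X. 2 ^ k * T < avg L}. m L))"
    unfolding sum.inter_filter[OF finite_below] sum_distrib_left by (subst sum.swap) (rule refl)
  also have "\<dots> \<le> T powr \<theta> * (m X / c) + (\<Sum>k<N. (2 ^ Suc k * T) powr \<theta> * (m X / 2 ^ k / c))"
    using all level by (intro add_mono mult_left_mono sum_mono) auto
  also have "\<dots> = T powr \<theta> * m X / c * (1 + 2 powr \<theta> * (\<Sum>k<N. q ^ k))"
    unfolding coef sum_distrib_left[symmetric] by (simp add: algebra_simps)
  also have "\<dots> \<le> T powr \<theta> * m X / c * (1 + 2 powr \<theta> * (1 / (1 - q)))"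
  proof -
    have "(\<Sum>k<N. q ^ k) \<le> (\<Sum>k. q ^ k)"
      using q by (intro sum_le_suminf summable_geometric) auto
    also have "\<dots> = 1 / (1 - q)" using q by (intro suminf_geometric) auto
    finally show ?thesis using T c_pos m[OF assms(3)]
      by (intro mult_left_mono add_left_mono) auto
  qed
  finally show ?thesis by (simp add: kolmogorov_const_def T_def m_def q_def mult_ac)
qed

section \<open>The testing estimate for finite families\<close>

definition tower :: "('a set \<Rightarrow> real) \<Rightarrow> 'a set set \<Rightarrow> 'a \<Rightarrow> real" where
  "tower a G x = (\<Sum>L\<in>G. a L * indicator L x)"

lemma tower_nonneg: "(\<And>L. L \<in> G \<Longrightarrow> 0 \<le> a L) \<Longrightarrow> 0 \<le> tower a G x"
  unfolding tower_def by (intro sum_nonneg) auto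

lemma tower_eq_sum: "finite G \<Longrightarrow> tower a G x = (\<Sum>L\<in>{L\<in>G. x \<in> L}. a L)"
  unfolding tower_def by (simp add: sum.inter_filter)

lemma tower_powr_le:
  assumes "finite G" "1 \<le> s" "\<And>L. L \<in> G \<Longrightarrow> 0 \<le> a L"
    and "\<And>L L'. L \<in> G \<Longrightarrow> L' \<in> G \<Longrightarrow> L \<subseteq> L' \<or> L' \<subseteq> L \<or> L \<inter> L' = {}"
  shows "tower a G x powr s \<le> (\<Sum>L\<in>G. s * a L * tower a {L'\<in>G. L' \<subseteq> L} x powr (s - 1))"
proof -
  let ?C = "{L\<in>G. x \<in> L}"
  have inner: "(\<Sum>L'\<in>{L'\<in>?C. L' \<subseteq> L}. a L') = tower a {L'\<in>G. L' \<subseteq> L} x" for L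
    using assms(1) by (subst tower_eq_sum) (auto intro!: sum.cong)
  have "tower a G x powr s = (\<Sum>L\<in>?C. a L) powr s" using tower_eq_sum[OF assms(1)] by metis
  also have "\<dots> \<le> s * (\<Sum>L\<in>?C. a L * (\<Sum>L'\<in>{L'\<in>?C. L' \<subseteq> L}. a L') powr (s - 1))"
  proof (intro chain_sum_powr_le)
    fix L L' assume "L \<in> ?C" "L' \<in> ?C"
    with assms(4)[of L L'] show "L \<subseteq> L' \<or> L' \<subseteq> L" by blast
  qed (use assms in auto)
  also have "\<dots> = (\<Sum>L\<in>?C. s * a L * tower a {L'\<in>G. L' \<subseteq> L} x powr (s - 1))"
    unfolding inner sum_distrib_left by (simp add: mult.assoc)
  also have "\<dots> \<le> (\<Sum>L\<in>G. s * a L * tower a {L'\<in>G. L' \<subseteq> L} x powr (s - 1))"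
    using assms by (intro sum_mono2) auto
  finally show ?thesis .
qed

context sparse_laminar
begin

lemma measurable_tower [measurable]: "G \<subseteq> F \<Longrightarrow> tower a G \<in> borel_measurable \<nu>"
  unfolding tower_def using sets_F sets_eq by (intro borel_measurable_sum) auto

text \<open>
  The inner tower vanishes outside \<open>L\<close> when \<open>s > 1\<close>, so the indicator of \<open>L\<close> coming from the outer sum
  is dropped without loss.
\<close>

lemma nn_integral_tower_powr_le:
  assumes "G \<subseteq> F" "\<And>L. L \<in> G \<Longrightarrow> below L \<subseteq> G" "1 \<le> s" "\<And>L. L \<in> F \<Longrightarrow> 0 \<le> a L"
  shows "(\<integral>\<^sup>+x. ennreal (tower a G x powr s) \<partial>\<nu>)
       \<le> (\<Sum>L\<in>G. ennreal (s * a L) * (\<integral>\<^sup>+x. ennreal (tower a (below L) x powr (s - 1)) \<partial>\<nu>))"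
proof -
  have fG: "finite G" by (rule finite_subset[OF assms(1) finite_F])
  have bl: "{L'\<in>G. L' \<subseteq> L} = below L" if "L \<in> G" for L
    using that assms(1,2) by (auto simp: below_def)
  have "(\<integral>\<^sup>+x. ennreal (tower a G x powr s) \<partial>\<nu>)
      \<le> (\<integral>\<^sup>+x. (\<Sum>L\<in>G. ennreal (s * a L) * ennreal (tower a (below L) x powr (s - 1))) \<partial>\<nu>)"
  proof (intro nn_integral_mono)
    fix x
    have "tower a G x powr s \<le> (\<Sum>L\<in>G. s * a L * tower a {L'\<in>G. L' \<subseteq> L} x powr (s - 1))"
      using fG assms laminar by (intro tower_powr_le) blast+
    also have "\<dots> = (\<Sum>L\<in>G. s * a L * tower a (below L) x powr (s - 1))"
      using bl by simp
    finally have "ennreal (tower a G x powr s)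
        \<le> ennreal (\<Sum>L\<in>G. s * a L * tower a (below L) x powr (s - 1))"
      by (intro ennreal_leI)
    also have "\<dots> = (\<Sum>L\<in>G. ennreal (s * a L) * ennreal (tower a (below L) x powr (s - 1)))"
      using assms by (subst sum_ennreal[symmetric]) (auto intro!: sum.cong ennreal_mult)
    finally show "ennreal (tower a G x powr s)
        \<le> (\<Sum>L\<in>G. ennreal (s * a L) * ennreal (tower a (below L) x powr (s - 1)))" .
  qed
  also have "\<dots> = (\<Sum>L\<in>G. ennreal (s * a L) * (\<integral>\<^sup>+x. ennreal (tower a (below L) x powr (s - 1)) \<partial>\<nu>))"
    using belowD by (subst nn_integral_sum) (auto intro!: sum.cong nn_integral_cmult simp: subset_eq)
  finally show ?thesis .
qed

lemma nn_integral_tower_powr_le_small: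
  assumes "G \<subseteq> F" "0 < s" "s \<le> 1" "\<And>L. L \<in> F \<Longrightarrow> 0 \<le> a L"
  shows "(\<integral>\<^sup>+x. ennreal (tower a G x powr s) \<partial>\<nu>) \<le> ennreal (\<Sum>L\<in>G. a L powr s * measure \<nu> L)"
proof -
  have fG: "finite G" by (rule finite_subset[OF assms(1) finite_F])
  have "(\<integral>\<^sup>+x. ennreal (tower a G x powr s) \<partial>\<nu>)
      \<le> (\<integral>\<^sup>+x. (\<Sum>L\<in>G. ennreal (a L powr s) * indicator L x) \<partial>\<nu>)"
  proof (intro nn_integral_mono)
    fix x
    have "tower a G x powr s \<le> (\<Sum>L\<in>G. (a L * indicator L x) powr s)"
      unfolding tower_def using assms fG by (intro sum_powr_le_powr_sum) auto
    also have "\<dots> = (\<Sum>L\<in>G. a L powr s * indicator L x)"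
      by (intro sum.cong refl) (auto simp: indicator_def)
    finally have "ennreal (tower a G x powr s) \<le> ennreal (\<Sum>L\<in>G. a L powr s * indicator L x)"
      by (intro ennreal_leI)
    also have "\<dots> = (\<Sum>L\<in>G. ennreal (a L powr s) * indicator L x)"
      by (subst sum_ennreal[symmetric]) (auto simp: ennreal_mult ennreal_indicator)
    finally show "ennreal (tower a G x powr s) \<le> (\<Sum>L\<in>G. ennreal (a L powr s) * indicator L x)" .
  qed
  also have "\<dots> = (\<Sum>L\<in>G. ennreal (a L powr s) * emeasure \<nu> L)"
    using assms(1) sets_F sets_eq
    by (subst nn_integral_sum) (auto intro!: sum.cong nn_integral_cmult_indicator simp: subset_eq)
  also have "\<dots> = (\<Sum>L\<in>G. ennreal (a L powr s * measure \<nu> L))"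
    using assms(1) finite_mass(2)
    by (intro sum.cong refl) (auto simp: ennreal_mult emeasure_eq_ennreal_measure subset_eq)
  finally show ?thesis by simp
qed

end

text \<open>
  The exponents are forced by homogeneity: the bound is invariant under rescaling \<open>\<nu>\<close>, \<open>\<mu>\<close> and \<open>a\<close>.
  The induction over \<open>n \<ge> s\<close> lowers \<open>s\<close> by one; after inserting \<open>a L \<le> B * avg L powr (-r)\<close> the factor
  \<open>avg L powr (1 - r * (s - 1))\<close> of the induction hypothesis becomes \<open>avg L powr (1 - r * s)\<close>, to which
  Kolmogorov's inequality applies with \<open>\<theta> = 1 - r * s\<close>. The condition \<open>r * s \<le> 1\<close> says \<open>\<theta> \<ge> 0\<close>.
  The constant must not depend on the family, hence the quantifier over all measures and families.
\<close>

lemma local_testing: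
  fixes c r s :: real and n :: nat
  assumes "0 < c" "0 < r" "0 < s" "r * s \<le> 1" "s \<le> n"
  shows "\<exists>C>0. \<forall>(\<mu>::'a measure) \<nu> F a B X.
    sparse_laminar \<mu> \<nu> F c \<longrightarrow> X \<in> F \<longrightarrow> 0 \<le> B \<longrightarrow>
    (\<forall>L\<in>F. 0 \<le> a L \<and> a L * sparse_laminar.avg \<mu> \<nu> L powr r \<le> B) \<longrightarrow>
    (\<integral>\<^sup>+x. ennreal (tower a (sparse_laminar.below F X) x powr s) \<partial>\<nu>)
      \<le> ennreal (C * (B powr s * sparse_laminar.avg \<mu> \<nu> X powr (1 - r * s) * measure \<mu> X))"
  using assms(3-5)
proof (induction n arbitrary: s)
  case 0
  then show ?case by simp
next
  case (Suc n)
  define K where "K = kolmogorov_const c (1 - r * s)"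
  have K: "0 < K" using assms Suc.prems by (simp add: K_def kolmogorov_const_pos)
  show ?case
  proof (cases "s \<le> 1")
    case True
    show ?thesis
    proof (intro exI conjI allI impI)
      fix \<mu> \<nu> :: "'a measure" and F :: "'a set set" and a :: "'a set \<Rightarrow> real" and B :: real and X
      assume "sparse_laminar \<mu> \<nu> F c"
      then interpret sparse_laminar \<mu> \<nu> F c .
      assume X: "X \<in> F" and "0 \<le> B" and *: "\<forall>L\<in>F. 0 \<le> a L \<and> a L * avg L powr r \<le> B"
      have "(\<integral>\<^sup>+x. ennreal (tower a (below X) x powr s) \<partial>\<nu>)
          \<le> ennreal (\<Sum>L\<in>below X. a L powr s * measure \<nu> L)"
        using * True Suc.prems belowD by (intro nn_integral_tower_powr_le_small) auto
      also have "(\<Sum>L\<in>below X. a L powr s * measure \<nu> L)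
          \<le> (\<Sum>L\<in>below X. B powr s * (avg L powr (1 - r * s) * measure \<mu> L))"
      proof (intro sum_mono)
        fix L assume "L \<in> below X"
        then have L: "L \<in> F" by (rule belowD)
        have pos: "0 < avg L" "0 < measure \<mu> L" using L avg_pos pos_mass by auto
        have "(a L * avg L powr r) powr s \<le> B powr s"
          using * L Suc.prems by (intro powr_mono2) auto
        then have "a L powr s * avg L powr (r * s) \<le> B powr s"
          using * L by (simp add: powr_mult powr_powr)
        then have "a L powr s * avg L powr (r * s) * (avg L powr (1 - r * s) * measure \<mu> L)
            \<le> B powr s * (avg L powr (1 - r * s) * measure \<mu> L)"
          using pos by (intro mult_right_mono) auto
        moreover have "avg L powr (r * s) * avg L powr (1 - r * s) = avg L"
          using pos by (simp add: powr_add[symmetric])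
        moreover have "avg L * measure \<mu> L = measure \<nu> L" using pos by (simp add: avg_def)
        ultimately show "a L powr s * measure \<nu> L \<le> B powr s * (avg L powr (1 - r * s) * measure \<mu> L)"
          by (metis mult.assoc)
      qed
      also have "\<dots> \<le> B powr s * (K * (avg X powr (1 - r * s) * measure \<mu> X))"
        unfolding sum_distrib_left[symmetric] K_def using X Suc.prems assms
        by (intro mult_left_mono kolmogorov_inequality) auto
      finally show "(\<integral>\<^sup>+x. ennreal (tower a (below X) x powr s) \<partial>\<nu>)
          \<le> ennreal (K * (B powr s * avg X powr (1 - r * s) * measure \<mu> X))"
        by (simp add: mult_ac ennreal_leI)
    qed (rule K)
  next
    case False
    have "r * (s - 1) \<le> 1" using assms Suc.prems by (simp add: algebra_simps)
    then obtain C where C: "0 < C" and IH: "\<forall>(\<mu>::'a measure) \<nu> F a B X.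
      sparse_laminar \<mu> \<nu> F c \<longrightarrow> X \<in> F \<longrightarrow> 0 \<le> B \<longrightarrow>
      (\<forall>L\<in>F. 0 \<le> a L \<and> a L * sparse_laminar.avg \<mu> \<nu> L powr r \<le> B) \<longrightarrow>
      (\<integral>\<^sup>+x. ennreal (tower a (sparse_laminar.below F X) x powr (s - 1)) \<partial>\<nu>)
        \<le> ennreal (C * (B powr (s - 1) * sparse_laminar.avg \<mu> \<nu> X powr (1 - r * (s - 1)) * measure \<mu> X))"
      using Suc.IH[of "s - 1"] Suc.prems False by auto
    show ?thesis
    proof (intro exI conjI allI impI)
      show "0 < s * C * K" using C K Suc.prems by simp
      fix \<mu> \<nu> :: "'a measure" and F :: "'a set set" and a :: "'a set \<Rightarrow> real" and B :: real and X
      assume sl: "sparse_laminar \<mu> \<nu> F c"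
      then interpret sparse_laminar \<mu> \<nu> F c .
      assume X: "X \<in> F" and B: "0 \<le> B" and *: "\<forall>L\<in>F. 0 \<le> a L \<and> a L * avg L powr r \<le> B"
      have "(\<integral>\<^sup>+x. ennreal (tower a (below X) x powr s) \<partial>\<nu>)
          \<le> (\<Sum>L\<in>below X. ennreal (s * a L) * (\<integral>\<^sup>+x. ennreal (tower a (below L) x powr (s - 1)) \<partial>\<nu>))"
        using * False by (intro nn_integral_tower_powr_le) (auto simp: below_def)
      also have "\<dots> \<le> (\<Sum>L\<in>below X.
          ennreal (s * C * (B powr s * (avg L powr (1 - r * s) * measure \<mu> L))))"
      proof (intro sum_mono)
        fix L assume "L \<in> below X"
        then have L: "L \<in> F" by (rule belowD)
        have pos: "0 < avg L" "0 < measure \<mu> L" using L avg_pos pos_mass by auto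
        have "ennreal (s * a L) * (\<integral>\<^sup>+x. ennreal (tower a (below L) x powr (s - 1)) \<partial>\<nu>)
            \<le> ennreal (s * a L) * ennreal (C * (B powr (s - 1) * avg L powr (1 - r * (s - 1)) * measure \<mu> L))"
          using IH sl L B * by (intro mult_left_mono) auto
        also have "\<dots> = ennreal (s * a L * (C * (B powr (s - 1) * avg L powr (1 - r * (s - 1)) * measure \<mu> L)))"
          using * L C Suc.prems by (intro ennreal_mult[symmetric]) auto
        also have "\<dots> \<le> ennreal (s * C * (B powr s * (avg L powr (1 - r * s) * measure \<mu> L)))"
        proof (rule ennreal_leI)
          have "avg L powr (1 - r * (s - 1)) = avg L powr r * avg L powr (1 - r * s)"
            by (simp add: powr_add[symmetric] algebra_simps)
          then have "s * a L * (C * (B powr (s - 1) * avg L powr (1 - r * (s - 1)) * measure \<mu> L))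
              = s * C * (((a L * avg L powr r) * B powr (s - 1)) * (avg L powr (1 - r * s) * measure \<mu> L))"
            by simp
          also have "\<dots> \<le> s * C * ((B * B powr (s - 1)) * (avg L powr (1 - r * s) * measure \<mu> L))"
            using * L C Suc.prems by (intro mult_left_mono mult_right_mono) auto
          also have "B * B powr (s - 1) = B powr s"
            using B by (cases "B = 0") (auto simp: powr_diff)
          finally show "s * a L * (C * (B powr (s - 1) * avg L powr (1 - r * (s - 1)) * measure \<mu> L))
              \<le> s * C * (B powr s * (avg L powr (1 - r * s) * measure \<mu> L))" .
        qed
        finally show "ennreal (s * a L) * (\<integral>\<^sup>+x. ennreal (tower a (below L) x powr (s - 1)) \<partial>\<nu>)
            \<le> ennreal (s * C * (B powr s * (avg L powr (1 - r * s) * measure \<mu> L)))" .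
      qed
      also have "\<dots> = ennreal (s * C * (B powr s * (\<Sum>L\<in>below X. avg L powr (1 - r * s) * measure \<mu> L)))"
        using C Suc.prems by (subst sum_ennreal) (auto simp: sum_distrib_left)
      also have "\<dots> \<le> ennreal (s * C * (B powr s * (K * (avg X powr (1 - r * s) * measure \<mu> X))))"
        unfolding K_def using X Suc.prems assms C
        by (intro ennreal_leI mult_left_mono kolmogorov_inequality) auto
      finally show "(\<integral>\<^sup>+x. ennreal (tower a (below X) x powr s) \<partial>\<nu>)
          \<le> ennreal (s * C * K * (B powr s * avg X powr (1 - r * s) * measure \<mu> X))"
        by (simp add: mult_ac)
    qed
  qed
qed

text \<open>
  At the endpoint \<open>r * s = 1\<close> of the local bound the average of \<open>\<nu>\<close> drops out, and
  \<open>B powr (p - 1)\<close> is the constant \<open>A\<close> to the first power.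
\<close>

lemma finite_testing:
  fixes c p :: real
  assumes "0 < c" "1 < p"
  shows "\<exists>C>0. \<forall>(\<mu>::'a measure) \<nu> F a A.
    sparse_laminar \<mu> \<nu> F c \<longrightarrow> 0 \<le> A \<longrightarrow>
    (\<forall>L\<in>F. 0 \<le> a L \<and> measure \<nu> L / measure \<mu> L * a L powr (p - 1) \<le> A) \<longrightarrow>
    (\<integral>\<^sup>+x. ennreal (tower a F x powr p) \<partial>\<nu>)
      \<le> ennreal (C * A * (\<Sum>L\<in>F. a L * measure \<mu> L))"
proof -
  define r where "r = 1 / (p - 1)"
  have r: "0 < r" "r * (p - 1) = 1" using assms by (auto simp: r_def)
  have "\<exists>n::nat. p - 1 \<le> n" by (rule real_arch_simple)
  then obtain n :: nat where n: "p - 1 \<le> n" ..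
  obtain C where C: "0 < C" and loc: "\<forall>(\<mu>::'a measure) \<nu> F a B X.
      sparse_laminar \<mu> \<nu> F c \<longrightarrow> X \<in> F \<longrightarrow> 0 \<le> B \<longrightarrow>
      (\<forall>L\<in>F. 0 \<le> a L \<and> a L * sparse_laminar.avg \<mu> \<nu> L powr r \<le> B) \<longrightarrow>
      (\<integral>\<^sup>+x. ennreal (tower a (sparse_laminar.below F X) x powr (p - 1)) \<partial>\<nu>)
        \<le> ennreal (C * (B powr (p - 1) * sparse_laminar.avg \<mu> \<nu> X powr (1 - r * (p - 1)) * measure \<mu> X))"
    using local_testing[of c r "p - 1" n, where ?'a = 'a] assms r n by auto
  show ?thesis
  proof (intro exI conjI allI impI)
    show "0 < p * C" using C assms by simp
    fix \<mu> \<nu> :: "'a measure" and F :: "'a set set" and a :: "'a set \<Rightarrow> real" and A :: real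
    assume sl: "sparse_laminar \<mu> \<nu> F c"
    then interpret sparse_laminar \<mu> \<nu> F c .
    assume A: "0 \<le> A" and "\<forall>L\<in>F. 0 \<le> a L \<and> measure \<nu> L / measure \<mu> L * a L powr (p - 1) \<le> A"
    then have a: "\<And>L. L \<in> F \<Longrightarrow> 0 \<le> a L" "\<And>L. L \<in> F \<Longrightarrow> avg L * a L powr (p - 1) \<le> A"
      by (auto simp: avg_def)
    define B where "B = A powr r"
    have B: "0 \<le> B" "B powr (p - 1) = A"
      using A r by (auto simp: B_def powr_powr)
    have aB: "a L * avg L powr r \<le> B" if L: "L \<in> F" for L
    proof -
      have "(avg L * a L powr (p - 1)) powr r \<le> B"
        unfolding B_def using a L r avg_pos[OF L] by (intro powr_mono2) auto
      then show ?thesis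
        using a L r avg_pos[OF L] by (simp add: powr_mult powr_powr mult.commute)
    qed
    have "(\<integral>\<^sup>+x. ennreal (tower a F x powr p) \<partial>\<nu>)
        \<le> (\<Sum>L\<in>F. ennreal (p * a L) * (\<integral>\<^sup>+x. ennreal (tower a (below L) x powr (p - 1)) \<partial>\<nu>))"
      using a assms by (intro nn_integral_tower_powr_le) (auto simp: below_def)
    also have "\<dots> \<le> (\<Sum>L\<in>F. ennreal (p * a L) * ennreal (C * (A * measure \<mu> L)))"
    proof (intro sum_mono mult_left_mono)
      fix L assume L: "L \<in> F"
      have "(\<integral>\<^sup>+x. ennreal (tower a (below L) x powr (p - 1)) \<partial>\<nu>)
        \<le> ennreal (C * (B powr (p - 1) * avg L powr (1 - r * (p - 1)) * measure \<mu> L))"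
        using loc sl L B a aB by blast
      then show "(\<integral>\<^sup>+x. ennreal (tower a (below L) x powr (p - 1)) \<partial>\<nu>) \<le> ennreal (C * (A * measure \<mu> L))"
        using r B avg_pos[OF L] by simp
    qed simp
    also have "\<dots> = (\<Sum>L\<in>F. ennreal (p * a L * (C * (A * measure \<mu> L))))"
      using a C A assms by (intro sum.cong refl ennreal_mult[symmetric]) auto
    also have "\<dots> = ennreal (\<Sum>L\<in>F. p * a L * (C * (A * measure \<mu> L)))"
      using a C A assms by (intro sum_ennreal) auto
    also have "(\<Sum>L\<in>F. p * a L * (C * (A * measure \<mu> L))) = p * C * A * (\<Sum>L\<in>F. a L * measure \<mu> L)"
      by (simp add: sum_distrib_left mult_ac)
    finally show "(\<integral>\<^sup>+x. ennreal (tower a F x powr p) \<partial>\<nu>)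
        \<le> ennreal (p * C * A * (\<Sum>L\<in>F. a L * measure \<mu> L))" .
  qed
qed

section \<open>Dyadic cubes\<close>

lemma hcube_box_subset:
  fixes a :: "real ^ 'n"
  shows "box a (\<chi> i. a $ i + l) \<subseteq> hcube a l" "hcube a l \<subseteq> cbox a (\<chi> i. a $ i + l)"
  unfolding hcube_def subset_iff mem_box_cart mem_Collect_eq vec_lambda_beta
  by (blast intro: less_imp_le)+

lemma hcube_sets_borel: "hcube a l \<in> sets borel"
proof -
  have "hcube a l = (\<Inter>i. {x. a $ i \<le> x $ i} \<inter> {x. x $ i < a $ i + l})"
    by (auto simp: hcube_def)
  then show ?thesis
    by (auto intro!: sets.finite_INT sets.Int borel_closed borel_open
        closed_halfspace_component_ge_cart open_halfspace_component_lt_cart)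
qed

lemma cubes_sets_lebesgue: "Q \<in> cubes \<Longrightarrow> Q \<in> sets lebesgue"
  using hcube_sets_borel by (fastforce simp: cubes_def intro: sets_completionI_sets)

lemma cube_subset_compact:
  assumes "Q \<in> cubes"
  obtains K where "compact K" "Q \<subseteq> K"
proof -
  obtain a l where "Q = hcube a l" using assms by (auto simp: cubes_def)
  with hcube_box_subset(2)[of a l] show thesis by (intro that[OF compact_cbox]) simp
qed

lemma emeasure_cube_finite:
  assumes "Q \<in> cubes"
  shows "emeasure lebesgue Q \<noteq> \<infinity>"
proof -
  obtain a l where Q: "Q = hcube a l" using assms by (auto simp: cubes_def)
  have "emeasure lebesgue Q \<le> emeasure lebesgue (cbox a (\<chi> i. a $ i + l))"
    unfolding Q by (intro emeasure_mono hcube_box_subset) auto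
  also have "\<dots> < \<infinity>" using emeasure_lborel_cbox_finite by auto
  finally show ?thesis by auto
qed

lemma emeasure_cube_pos:
  assumes "Q \<in> cubes"
  shows "0 < emeasure lebesgue Q"
proof -
  obtain a l where Q: "Q = hcube a l" "0 < l" using assms by (auto simp: cubes_def)
  let ?b = "box a (\<chi> i. a $ i + l)"
  have "?b \<noteq> {}" using Q by (auto simp: interval_ne_empty_cart)
  then have "emeasure lebesgue ?b \<noteq> 0"
    using open_box[of a "\<chi> i. a $ i + l"] open_not_negligible negligible_iff_emeasure0
    by (metis lmeasurable_box fmeasurableD)
  moreover have "emeasure lebesgue ?b \<le> emeasure lebesgue Q"
    using assms unfolding Q(1) by (intro emeasure_mono hcube_box_subset) (auto simp: hcube_sets_borel)
  ultimately show ?thesis by (auto simp: zero_less_iff_neq_zero)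
qed

lemma dyadic_subset_cubes: "dyadic_cubes \<subseteq> cubes"
proof
  fix Q assume "Q \<in> dyadic_cubes"
  then obtain k :: int and m where "Q = hcube (\<chi> i. 2 powi k * of_int (m i)) (2 powi k)"
    unfolding dyadic_cubes_def by blast
  moreover have "(0::real) < 2 powi k" by simp
  ultimately show "Q \<in> cubes" unfolding cubes_def by blast
qed

lemma countable_dyadic_cubes: "countable (dyadic_cubes :: (real ^ 'n) set set)"
proof -
  have eq: "dyadic_cubes = (\<lambda>(k :: int, m :: 'n \<Rightarrow> int). hcube (\<chi> i. 2 powi k * of_int (m i)) (2 powi k)) ` UNIV"
    by (auto simp: dyadic_cubes_def)
  show ?thesis unfolding eq by (rule countable_image) (rule countableI_type)
qed

text \<open>
  The lattice of scale \<open>k\<close> refines that of scale \<open>k' \<ge> k\<close>: after division by \<open>2 powi k\<close> all four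
  endpoints are integers, and an integer strictly below \<open>m + 1\<close> is at most \<open>m\<close>.
\<close>

lemma dyadic_interval_subset:
  fixes m m' k k' :: int and x y :: real
  assumes "k \<le> k'"
    and "2 powi k * m \<le> x" "x < 2 powi k * m + 2 powi k"
    and "2 powi k' * m' \<le> x" "x < 2 powi k' * m' + 2 powi k'"
    and "2 powi k * m \<le> y" "y < 2 powi k * m + 2 powi k"
  shows "2 powi k' * m' \<le> y \<and> y < 2 powi k' * m' + 2 powi k'"
proof -
  define h :: real where "h = 2 powi k"
  define N :: int where "N = 2 ^ nat (k' - k)"
  have h: "0 < h" by (simp add: h_def)
  have "(2::real) powi k' = 2 powi (k + (k' - k))" by simp
  also have "\<dots> = h * 2 powi (k' - k)" unfolding h_def by (rule power_int_add) simp
  also have "(2::real) powi (k' - k) = N" using assms(1) by (simp add: power_int_def N_def)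
  finally have k': "2 powi k' = h * N" .
  have "h * (N * m') < h * (m + 1)" "h * m < h * (N * (m' + 1))"
    using assms(2-5) unfolding k' h_def[symmetric] by (auto simp: algebra_simps)
  then have "real_of_int (N * m') < real_of_int (m + 1)" "real_of_int m < real_of_int (N * (m' + 1))"
    using h by (auto simp: mult_less_cancel_left_pos)
  then have "N * m' \<le> m" "m + 1 \<le> N * (m' + 1)" by linarith+
  then have "real_of_int (N * m') \<le> m" "real_of_int (m + 1) \<le> real_of_int (N * (m' + 1))"
    by (simp_all only: of_int_le_iff)
  then have "h * real_of_int (N * m') \<le> h * m" "h * real_of_int (m + 1) \<le> h * real_of_int (N * (m' + 1))"
    using h by (auto intro!: mult_left_mono simp only: less_imp_le)
  then show ?thesis
    using assms(6,7) unfolding k' h_def[symmetric]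
    by (simp only: of_int_mult of_int_add of_int_1 distrib_left mult_1_right mult.assoc) linarith
qed

lemma dyadic_cubes_laminar:
  assumes "L \<in> dyadic_cubes" "L' \<in> dyadic_cubes"
  shows "L \<subseteq> L' \<or> L' \<subseteq> L \<or> L \<inter> L' = {}"
proof -
  have nested: "hcube (\<chi> i. 2 powi k * of_int (m i)) (2 powi k)
      \<subseteq> hcube (\<chi> i. 2 powi k' * of_int (m' i)) (2 powi k')"
    if "k \<le> k'" "x \<in> hcube (\<chi> i. 2 powi k * of_int (m i)) (2 powi k)"
      "x \<in> hcube (\<chi> i. 2 powi k' * of_int (m' i)) (2 powi k')" for x :: "real ^ 'n" and k k' m m'
    using that dyadic_interval_subset[OF that(1)] unfolding hcube_def by (simp add: subset_iff) blast
  obtain k m k' m' where L: "L = hcube (\<chi> i. 2 powi k * of_int (m i)) (2 powi k)"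
    "L' = hcube (\<chi> i. 2 powi k' * of_int (m' i)) (2 powi k')"
    using assms by (auto simp: dyadic_cubes_def)
  show ?thesis
  proof (cases "L \<inter> L' = {}")
    case False
    then obtain x where "x \<in> L" "x \<in> L'" by auto
    then show ?thesis using nested[of k k'] nested[of k' k] unfolding L
      by (metis linear)
  qed simp
qed

section \<open>Weights and their averages\<close>

lemma ennreal_divide_mult_cancel:
  fixes x y :: ennreal
  assumes "y \<noteq> 0" "y \<noteq> \<infinity>"
  shows "x / y * y = x"
  using assms by (simp add: ennreal_divide_times ennreal_divide_self less_top)

lemma locally_integrable_measurable:
  fixes f :: "real ^ 'n \<Rightarrow> real"
  assumes "locally_integrable f"
  shows "f \<in> borel_measurable lebesgue"
proof (rule borel_measurable_LIMSEQ_real)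
  \<comment> \<open>Local integrability only provides measurability of the truncations to balls.\<close>
  show "(\<lambda>x. indicator (cball 0 (real n)) x * f x) \<in> borel_measurable lebesgue" for n
  proof -
    have "set_integrable lebesgue (cball 0 (real n)) f"
      using assms compact_cball unfolding locally_integrable_def by blast
    then show ?thesis unfolding set_integrable_def by (auto dest: borel_measurable_integrable)
  qed
  fix x :: "real ^ 'n"
  obtain n where "norm x \<le> real n" using real_arch_simple by blast
  then have "\<forall>\<^sub>F m in sequentially. indicator (cball 0 (real m)) x * f x = f x"
    unfolding eventually_sequentially by (intro exI[of _ n]) auto
  then show "(\<lambda>n. indicator (cball 0 (real n)) x * f x) \<longlonglongrightarrow> f x"
    by (rule tendsto_eventually)
qed

lemma weight_measurable:
  "weight w \<Longrightarrow> (\<lambda>x. ennreal (w x)) \<in> borel_measurable lebesgue"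
  using locally_integrable_measurable[of w]
  by (intro measurable_compose[OF _ measurable_ennreal]) (simp add: weight_def)

abbreviation weight_measure :: "(real ^ 'n \<Rightarrow> real) \<Rightarrow> (real ^ 'n) measure" where
  "weight_measure w \<equiv> density lebesgue (\<lambda>x. ennreal (w x))"

lemma emeasure_weight_measure:
  "weight w \<Longrightarrow> Q \<in> cubes \<Longrightarrow> emeasure (weight_measure w) Q = weight_mass w Q"
  unfolding weight_mass_def by (intro emeasure_density weight_measurable cubes_sets_lebesgue)

lemma weight_mass_finite:
  assumes "weight w" "Q \<in> cubes"
  shows "weight_mass w Q \<noteq> \<infinity>"
proof -
  obtain K where K: "compact K" "Q \<subseteq> K" using cube_subset_compact[OF assms(2)] .
  have "set_integrable lebesgue K w" using assms K by (auto simp: weight_def locally_integrable_def)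
  then have "(\<integral>\<^sup>+x. ennreal (norm (indicator K x *\<^sub>R w x)) \<partial>lebesgue) < \<infinity>"
    unfolding set_integrable_def integrable_iff_bounded by auto
  moreover have "weight_mass w Q \<le> (\<integral>\<^sup>+x. ennreal (norm (indicator K x *\<^sub>R w x)) \<partial>lebesgue)"
    unfolding weight_mass_def using K(2)
    by (intro nn_integral_mono) (auto simp: indicator_def intro!: ennreal_leI)
  ultimately show ?thesis by auto
qed

lemma weight_mass_nonzero:
  assumes "weight w" "Q \<in> cubes"
  shows "weight_mass w Q \<noteq> 0"
proof
  assume "weight_mass w Q = 0"
  moreover have Q: "Q \<in> sets lebesgue" using assms cubes_sets_lebesgue by auto
  moreover have "(\<lambda>x. ennreal (w x) * indicator Q x) \<in> borel_measurable lebesgue"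
    using weight_measurable[OF assms(1)] Q by (intro borel_measurable_times_ennreal borel_measurable_indicator)
  ultimately have "AE x in lebesgue. ennreal (w x) * indicator Q x = 0"
    unfolding weight_mass_def by (subst (asm) nn_integral_0_iff_AE)
  moreover have "AE x in lebesgue. 0 < w x" using assms by (simp add: weight_def)
  ultimately have "AE x in lebesgue. x \<notin> Q" by eventually_elim (auto simp: indicator_def)
  then have "emeasure lebesgue Q = 0" using Q
    by (subst (asm) AE_iff_measurable[of Q]) auto
  with emeasure_cube_pos[OF assms(2)] show False by simp
qed

lemma cube_avg_weight:
  "cube_avg (\<lambda>x. ennreal (w x)) Q = weight_mass w Q / emeasure lebesgue Q"
  by (simp add: cube_avg_def weight_mass_def)

lemma measure_cube_pos: "Q \<in> cubes \<Longrightarrow> 0 < measure lebesgue Q"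
  unfolding measure_def enn2real_positive_iff
  using emeasure_cube_pos[of Q] emeasure_cube_finite[of Q] by (simp add: less_top)

lemma emeasure_cube: "Q \<in> cubes \<Longrightarrow> emeasure lebesgue Q = ennreal (measure lebesgue Q)"
  by (rule emeasure_eq_ennreal_measure) (metis emeasure_cube_finite infinity_ennreal_def)

lemma weight_mass_eq_measure:
  assumes "weight w" "Q \<in> cubes"
  shows "weight_mass w Q = ennreal (measure (weight_measure w) Q)"
  using weight_mass_finite[OF assms]
  by (subst emeasure_eq_ennreal_measure[symmetric]) (simp_all add: emeasure_weight_measure[OF assms])

lemma measure_weight_pos:
  assumes "weight w" "Q \<in> cubes"
  shows "0 < measure (weight_measure w) Q"
  using weight_mass_nonzero[OF assms] unfolding weight_mass_eq_measure[OF assms]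
  by (simp add: zero_less_measure_iff ennreal_eq_0_iff not_le)

lemma cube_avg_eq:
  assumes "weight w" "Q \<in> cubes"
  shows "cube_avg (\<lambda>x. ennreal (w x)) Q = ennreal (measure (weight_measure w) Q / measure lebesgue Q)"
  unfolding cube_avg_weight weight_mass_eq_measure[OF assms] emeasure_cube[OF assms(2)]
  by (intro divide_ennreal measure_nonneg measure_cube_pos assms)

section \<open>Packing and the $A_\infty$ constant\<close>

text \<open>
  Trading \<open>|L|\<close> for \<open>|E(L)|\<close> writes the sum as the integral of a function that on \<open>E(L)\<close> is the average
  over \<open>L\<close>, hence is at most the maximal function of \<open>1\<^sub>Q \<sigma>\<close>, since \<open>L\<close> is one of the competing cubes.
\<close>

lemma carleson_weight_mass:
  assumes "weight \<sigma>" "sparse_family c \<L>" "Q \<in> cubes"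
    and G: "finite G" "G \<subseteq> {L \<in> \<L>. L \<subseteq> Q}"
  shows "ennreal c * (\<Sum>L\<in>G. weight_mass \<sigma> L) \<le> Ainf_const \<sigma> * weight_mass \<sigma> Q"
proof -
  define v where "v = (\<lambda>L. cube_avg (\<lambda>x. ennreal (\<sigma> x)) L)"
  define M where "M = HL_maximal (\<lambda>y. indicator Q y * \<sigma> y)"
  obtain E where E: "\<And>L. L \<in> \<L> \<Longrightarrow> E L \<subseteq> L \<and> E L \<in> sets lebesgue
      \<and> ennreal c * emeasure lebesgue L \<le> emeasure lebesgue (E L)"
    and disj: "disjoint_family_on E \<L>" and dy: "\<L> \<subseteq> dyadic_cubes"
    using assms(2) unfolding sparse_family_def by blast
  have cube: "L \<in> cubes" if "L \<in> G" for L using that G dy dyadic_subset_cubes by blast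
  have maximal: "v L \<le> M x" if "L \<in> G" "x \<in> L" for L x
  proof -
    have "AE y in lebesgue. ennreal (\<sigma> y) * indicator L y = ennreal \<bar>indicator Q y * \<sigma> y\<bar> * indicator L y"
    proof -
      have "AE y in lebesgue. 0 < \<sigma> y" using assms(1) by (simp add: weight_def)
      then show ?thesis
        by eventually_elim (use that G in \<open>auto simp: indicator_def\<close>)
    qed
    then have "v L = cube_avg (\<lambda>y. ennreal \<bar>indicator Q y * \<sigma> y\<bar>) L"
      unfolding v_def cube_avg_def by (intro arg_cong2[where f = "(/)"] nn_integral_cong_AE refl)
    also have "\<dots> \<le> M x"
      unfolding M_def HL_maximal_def using that cube by (intro SUP_upper) auto
    finally show ?thesis .
  qed
  have "ennreal c * (\<Sum>L\<in>G. weight_mass \<sigma> L) \<le> (\<Sum>L\<in>G. v L * emeasure lebesgue (E L))"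
    unfolding sum_distrib_left
  proof (intro sum_mono)
    fix L assume L: "L \<in> G"
    have "weight_mass \<sigma> L = v L * emeasure lebesgue L"
      unfolding v_def cube_avg_weight using emeasure_cube_pos[OF cube[OF L]] emeasure_cube_finite[OF cube[OF L]]
      by (simp add: ennreal_divide_mult_cancel)
    then have "ennreal c * weight_mass \<sigma> L = v L * (ennreal c * emeasure lebesgue L)"
      by (simp add: mult_ac)
    also have "\<dots> \<le> v L * emeasure lebesgue (E L)"
      using E G L by (intro mult_left_mono) auto
    finally show "ennreal c * weight_mass \<sigma> L \<le> v L * emeasure lebesgue (E L)" .
  qed
  also have "\<dots> = (\<integral>\<^sup>+x. (\<Sum>L\<in>G. v L * indicator (E L) x) \<partial>lebesgue)"
  proof (subst nn_integral_sum)
    have E': "E L \<in> sets lebesgue" if "L \<in> G" for L using E G that by blast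
    then show "(\<lambda>x. v L * indicator (E L) x) \<in> borel_measurable lebesgue" if "L \<in> G" for L
      using that by (intro borel_measurable_times_ennreal borel_measurable_indicator borel_measurable_const)
    show "(\<Sum>L\<in>G. v L * emeasure lebesgue (E L))
        = (\<Sum>L\<in>G. \<integral>\<^sup>+x. v L * indicator (E L) x \<partial>lebesgue)"
      using E' by (intro sum.cong refl nn_integral_cmult_indicator[symmetric])
  qed
  also have "\<dots> \<le> (\<integral>\<^sup>+x\<in>Q. M x \<partial>lebesgue)"
  proof (intro nn_integral_mono)
    fix x
    show "(\<Sum>L\<in>G. v L * indicator (E L) x) \<le> M x * indicator Q x"
    proof (cases "\<exists>L\<in>G. x \<in> E L")
      case True
      then obtain L where L: "L \<in> G" "x \<in> E L" by auto
      have "x \<notin> E L'" if "L' \<in> G - {L}" for L'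
      proof -
        have "E L' \<inter> E L = {}" using that L(1) G(2) disj unfolding disjoint_family_on_def by blast
        with L(2) show ?thesis by blast
      qed
      then have "(\<Sum>L\<in>G - {L}. v L * indicator (E L) x) = 0" by (intro sum.neutral) simp
      then have "(\<Sum>L\<in>G. v L * indicator (E L) x) = v L"
        using L by (simp add: sum.remove[OF G(1) L(1)])
      moreover have "x \<in> L" "x \<in> Q" using L G E by blast+
      ultimately show ?thesis using maximal L by simp
    next
      case False
      then have "(\<Sum>L\<in>G. v L * indicator (E L) x) = 0" by (intro sum.neutral) simp
      then show ?thesis by simp
    qed
  qed
  also have "\<dots> = (\<integral>\<^sup>+x\<in>Q. M x \<partial>lebesgue) / weight_mass \<sigma> Q * weight_mass \<sigma> Q"
    using weight_mass_finite[OF assms(1,3)] weight_mass_nonzero[OF assms(1,3)]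
    by (simp add: ennreal_divide_mult_cancel)
  also have "\<dots> \<le> Ainf_const \<sigma> * weight_mass \<sigma> Q"
    unfolding Ainf_const_def M_def using assms(3) by (intro mult_right_mono SUP_upper) auto
  finally show ?thesis .
qed

text \<open>
  The packing estimate for the one-cube family, whose sparseness constant is one, even gives that the
  \<open>A\<^sub>\<infinity>\<close> constant is at least one. This keeps the right-hand side infinite when the
  two-weight constant is infinite.
\<close>

lemma Ainf_const_nonzero:
  fixes \<sigma> :: "real ^ 'n \<Rightarrow> real" and Q :: "(real ^ 'n) set"
  assumes "weight \<sigma>" "Q \<in> dyadic_cubes"
  shows "Ainf_const \<sigma> \<noteq> 0"
proof
  assume *: "Ainf_const \<sigma> = 0"
  have Q: "Q \<in> cubes" using assms dyadic_subset_cubes by auto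
  have "sparse_family 1 {Q}"
    using assms Q unfolding sparse_family_def
    by (auto intro!: exI[of _ "\<lambda>L. L"] simp: cubes_sets_lebesgue disjoint_family_on_def)
  with carleson_weight_mass[OF assms(1) _ Q, of 1 "{Q}" "{Q}"] * weight_mass_nonzero[OF assms(1) Q]
  show False by simp
qed

section \<open>Finite subfamilies of a sparse family of dyadic cubes\<close>

lemma ennreal_powr_ennreal: "0 \<le> x \<Longrightarrow> ennreal_powr (ennreal x) t = ennreal (x powr t)"
  by (simp add: ennreal_powr_def)

lemma sparse_laminar_weight:
  assumes w: "weight w" and sp: "sparse_family c \<L>" and c: "0 < c"
    and G: "finite G" "G \<subseteq> \<L>"
  shows "sparse_laminar lebesgue (weight_measure w) G c"
proof
  have dy: "G \<subseteq> dyadic_cubes" using G sp unfolding sparse_family_def by blast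
  then have cube: "L \<in> cubes" if "L \<in> G" for L using that dyadic_subset_cubes by blast
  show "L \<in> sets lebesgue" "emeasure lebesgue L \<noteq> \<infinity>" "emeasure (weight_measure w) L \<noteq> \<infinity>"
    "0 < measure lebesgue L" "0 < measure (weight_measure w) L" if "L \<in> G" for L
    using cubes_sets_lebesgue[OF cube[OF that]] emeasure_cube_finite[OF cube[OF that]]
      weight_mass_finite[OF w cube[OF that]] measure_cube_pos[OF cube[OF that]]
      measure_weight_pos[OF w cube[OF that]]
    unfolding emeasure_weight_measure[OF w cube[OF that]] by auto
  show "L \<subseteq> L' \<or> L' \<subseteq> L \<or> L \<inter> L' = {}" if "L \<in> G" "L' \<in> G" for L L'
    using that dy dyadic_cubes_laminar by blast
  obtain E where E: "\<And>L. L \<in> \<L> \<Longrightarrow> E L \<subseteq> L \<and> E L \<in> sets lebesgue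
      \<and> ennreal c * emeasure lebesgue L \<le> emeasure lebesgue (E L)"
    and disj: "disjoint_family_on E \<L>" using sp unfolding sparse_family_def by blast
  have "c * measure lebesgue L \<le> measure lebesgue (E L)" if L: "L \<in> G" for L
  proof -
    have EL: "E L \<subseteq> L" "ennreal c * emeasure lebesgue L \<le> emeasure lebesgue (E L)"
      using E L G by blast+
    have "emeasure lebesgue (E L) \<le> emeasure lebesgue L"
      by (rule emeasure_mono[OF EL(1) cubes_sets_lebesgue[OF cube[OF L]]])
    then have "emeasure lebesgue (E L) < top"
      unfolding emeasure_cube[OF cube[OF L]] by (rule le_less_trans) simp
    with EL(2) have "enn2real (ennreal c * emeasure lebesgue L) \<le> enn2real (emeasure lebesgue (E L))"
      by (rule enn2real_mono)
    then show ?thesis using c by (simp add: measure_def enn2real_mult)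
  qed
  moreover have "disjoint_family_on E G" by (rule disjoint_family_on_mono[OF G(2) disj])
  ultimately show "\<exists>E. (\<forall>L\<in>G. E L \<subseteq> L \<and> E L \<in> sets lebesgue
      \<and> c * measure lebesgue L \<le> measure lebesgue (E L)) \<and> disjoint_family_on E G"
    using E G by blast
  show "sets (weight_measure w) = sets lebesgue" by (rule sets_density)
qed (rule G c)+

lemma avg_powr_le_Ap_const:
  assumes w: "weight w" and \<sigma>: "weight \<sigma>" and L: "L \<in> cubes"
    and A: "Ap_const p w \<sigma> = ennreal A" "0 \<le> A"
  shows "measure (weight_measure w) L / measure lebesgue L
    * (measure (weight_measure \<sigma>) L / measure lebesgue L) powr (p - 1) \<le> A"
proof -
  have "ennreal (measure (weight_measure w) L / measure lebesgue L
      * (measure (weight_measure \<sigma>) L / measure lebesgue L) powr (p - 1))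
      = cube_avg (\<lambda>x. ennreal (w x)) L * ennreal_powr (cube_avg (\<lambda>x. ennreal (\<sigma> x)) L) (p - 1)"
    unfolding cube_avg_eq[OF w L] cube_avg_eq[OF \<sigma> L]
    by (subst ennreal_powr_ennreal) (rule divide_nonneg_nonneg ennreal_mult measure_nonneg powr_ge_zero)+
  also have "\<dots> \<le> ennreal A"
    unfolding A(1)[symmetric] Ap_const_def by (rule SUP_upper[OF L])
  finally show ?thesis using A(2) by simp
qed

section \<open>Passage to infinite families\<close>

text \<open>
  The Galois connection replaces continuity of the power when it has to be moved past a supremum.
\<close>

lemma ennreal_powr_le_iff:
  assumes "0 < t"
  shows "ennreal_powr x t \<le> z \<longleftrightarrow> x \<le> ennreal_powr z (1 / t)"
proof (cases x; cases z)
  fix u v assume uv: "0 \<le> u" "0 \<le> v" "x = ennreal u" "z = ennreal v"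
  have "u powr t \<le> v \<longleftrightarrow> u \<le> v powr (1 / t)"
  proof
    assume "u powr t \<le> v"
    then have "(u powr t) powr (1 / t) \<le> v powr (1 / t)" using assms by (intro powr_mono2) auto
    then show "u \<le> v powr (1 / t)" using assms uv by (simp add: powr_powr)
  next
    assume "u \<le> v powr (1 / t)"
    then have "u powr t \<le> (v powr (1 / t)) powr t" using assms uv by (intro powr_mono2) auto
    then show "u powr t \<le> v" using assms uv by (simp add: powr_powr)
  qed
  with uv show ?thesis by (simp add: ennreal_powr_ennreal)
next
  assume "x = top" "z = top"
  then show ?thesis by (simp add: ennreal_powr_def)
next
  fix u assume "0 \<le> u" "x = ennreal u" "z = top"
  then show ?thesis by (simp add: ennreal_powr_def)
next
  fix v assume "0 \<le> v" "x = top" "z = ennreal v"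
  then show ?thesis by (simp add: ennreal_powr_def top_unique)
qed

lemma infsum_le_SUP_finite:
  fixes f :: "'a \<Rightarrow> ennreal"
  assumes "incseq G" "\<And>n. finite (G n)" "A \<subseteq> (\<Union>n. G n)"
  shows "infsum f A \<le> (SUP n. sum f (G n))"
proof -
  have "infsum f A = (SUP F\<in>{F. finite F \<and> F \<subseteq> A}. sum f F)" by (intro nonneg_infsum_complete) simp
  also have "\<dots> \<le> (SUP n. sum f (G n))"
  proof (intro SUP_least)
    fix F assume F: "F \<in> {F. finite F \<and> F \<subseteq> A}"
    have "\<exists>n. F \<subseteq> G n"
    proof -
      have "\<forall>x\<in>F. \<exists>n. x \<in> G n" using F assms(3) by auto
      then obtain k where k: "\<And>x. x \<in> F \<Longrightarrow> x \<in> G (k x)" by metis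
      have "G (k x) \<subseteq> G (Max (k ` F))" if "x \<in> F" for x
        using that F by (intro incseqD[OF assms(1)] Max_ge) auto
      with k show ?thesis by blast
    qed
    then obtain n where "F \<subseteq> G n" ..
    then have "sum f F \<le> sum f (G n)" using assms(2) by (intro sum_mono2) auto
    also have "\<dots> \<le> (SUP n. sum f (G n))" by (intro SUP_upper) simp
    finally show "sum f F \<le> (SUP n. sum f (G n))" .
  qed
  finally show ?thesis .
qed

lemma countable_exhaustion:
  assumes "countable A"
  obtains G :: "nat \<Rightarrow> 'a set" where "incseq G" "\<And>n. finite (G n)" "\<And>n. G n \<subseteq> A" "A \<subseteq> (\<Union>n. G n)"
proof
  let ?G = "\<lambda>n. {x \<in> A. to_nat_on A x < n}"
  show "incseq ?G" by (auto simp: incseq_def)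
  show "finite (?G n)" for n
    by (rule inj_on_finite[of "to_nat_on A" _ "{..<n}"])
       (auto intro: inj_on_subset[OF inj_on_to_nat_on[OF assms]])
  show "A \<subseteq> (\<Union>n. ?G n)" by auto
qed auto

lemma nn_integral_infsum_powr_le:
  fixes a :: "(real ^ 'n) set \<Rightarrow> real" and w :: "real ^ 'n \<Rightarrow> real"
  assumes w: "weight w" and p: "0 < p" and count: "countable \<G>"
    and \<G>: "\<And>L. L \<in> \<G> \<Longrightarrow> L \<in> sets lebesgue" "\<And>L. 0 \<le> a L"
    and bound: "\<And>G. finite G \<Longrightarrow> G \<subseteq> \<G> \<Longrightarrow>
      (\<integral>\<^sup>+x. ennreal (tower a G x powr p) \<partial>weight_measure w) \<le> R"
  shows "(\<integral>\<^sup>+x. ennreal_powr (\<Sum>\<^sub>\<infinity>L\<in>\<G>. ennreal (a L) * indicator L x) p * ennreal (w x) \<partial>lebesgue) \<le> R"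
proof -
  obtain G where G: "incseq G" "\<And>n. finite (G n)" "\<And>n. G n \<subseteq> \<G>" "\<G> \<subseteq> (\<Union>n. G n)"
    using countable_exhaustion[OF count] by metis
  define h where "h = (\<lambda>n x. ennreal (tower a (G n) x powr p))"
  have h: "h n x = ennreal_powr (\<Sum>L\<in>G n. ennreal (a L) * indicator L x) p" for n x
  proof -
    have "(\<Sum>L\<in>G n. ennreal (a L) * indicator L x) = (\<Sum>L\<in>G n. ennreal (a L * indicator L x))"
      by (intro sum.cong refl) (auto simp: indicator_def)
    also have "\<dots> = ennreal (tower a (G n) x)"
      unfolding tower_def using \<G>(2) by (intro sum_ennreal) auto
    finally show ?thesis by (simp add: h_def ennreal_powr_ennreal tower_nonneg \<G>(2))
  qed
  have h_meas: "h n \<in> borel_measurable lebesgue" for n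
  proof -
    have "tower a (G n) \<in> borel_measurable lebesgue"
      unfolding tower_def using G(3) \<G>(1)
      by (intro borel_measurable_sum borel_measurable_times borel_measurable_const borel_measurable_indicator) blast
    then show ?thesis unfolding h_def by measurable
  qed
  have h_mono: "h m x \<le> h n x" if "m \<le> n" for m n x
  proof -
    have "tower a (G m) x \<le> tower a (G n) x"
      unfolding tower_def using G(2) \<G>(2) incseqD[OF G(1) that] by (intro sum_mono2) auto
    then show ?thesis
      unfolding h_def using p \<G>(2) by (intro ennreal_leI powr_mono2 tower_nonneg) auto
  qed
  have le_SUP: "ennreal_powr (\<Sum>\<^sub>\<infinity>L\<in>\<G>. ennreal (a L) * indicator L x) p \<le> (SUP n. h n x)" for x
  proof -
    have "(\<Sum>\<^sub>\<infinity>L\<in>\<G>. ennreal (a L) * indicator L x)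
        \<le> (SUP n. \<Sum>L\<in>G n. ennreal (a L) * indicator L x)"
      by (rule infsum_le_SUP_finite[OF G(1,2,4)])
    also have "\<dots> \<le> ennreal_powr (SUP n. h n x) (1 / p)"
    proof (intro SUP_least)
      fix n
      have "h n x \<le> (SUP n. h n x)" by (intro SUP_upper) simp
      then show "(\<Sum>L\<in>G n. ennreal (a L) * indicator L x) \<le> ennreal_powr (SUP n. h n x) (1 / p)"
        unfolding h[of n] ennreal_powr_le_iff[OF p] .
    qed
    finally show ?thesis unfolding ennreal_powr_le_iff[OF p] .
  qed
  have "(\<integral>\<^sup>+x. ennreal_powr (\<Sum>\<^sub>\<infinity>L\<in>\<G>. ennreal (a L) * indicator L x) p * ennreal (w x) \<partial>lebesgue)
      \<le> (\<integral>\<^sup>+x. (SUP n. ennreal (w x) * h n x) \<partial>lebesgue)"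
  proof (intro nn_integral_mono)
    fix x
    show "ennreal_powr (\<Sum>\<^sub>\<infinity>L\<in>\<G>. ennreal (a L) * indicator L x) p * ennreal (w x)
        \<le> (SUP n. ennreal (w x) * h n x)"
      unfolding SUP_mult_left_ennreal[symmetric] mult.commute[of _ "ennreal (w x)"]
      by (intro mult_left_mono le_SUP) simp
  qed
  also have "\<dots> = (SUP n. \<integral>\<^sup>+x. ennreal (w x) * h n x \<partial>lebesgue)"
  proof (intro nn_integral_monotone_convergence_SUP)
    show "incseq (\<lambda>n x. ennreal (w x) * h n x)"
      unfolding incseq_def le_fun_def using h_mono by (auto intro!: mult_left_mono)
    show "(\<lambda>x. ennreal (w x) * h n x) \<in> borel_measurable lebesgue" for n
      by (intro borel_measurable_times_ennreal weight_measurable w h_meas)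
  qed
  also have "\<dots> = (SUP n. \<integral>\<^sup>+x. h n x \<partial>weight_measure w)"
    by (subst nn_integral_density[OF weight_measurable[OF w] h_meas]) (rule refl)
  also have "\<dots> \<le> R"
    unfolding h_def using bound G by (intro SUP_least) auto
  finally show ?thesis .
qed

section \<open>The mixed $A_p$--$A_\infty$ testing estimate\<close>

theorem mainTheorem3:
  fixes p c :: real
  assumes "1 < p" and "0 < c"
  shows "\<exists>C::real. 0 < C \<and>
    (\<forall>(w :: real ^ 'n \<Rightarrow> real) \<sigma> \<L> Q.
       weight w \<longrightarrow> weight \<sigma> \<longrightarrow> sparse_family c \<L> \<longrightarrow> Q \<in> dyadic_cubes \<longrightarrow>
       (\<integral>\<^sup>+x\<in>Q. ennreal_powr
            (\<Sum>\<^sub>\<infinity>L\<in>{L \<in> \<L>. L \<subseteq> Q}. cube_avg (\<lambda>y. ennreal (\<sigma> y)) L * indicator L x) p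
          * ennreal (w x) \<partial>lebesgue)
       \<le> ennreal C * Ap_const p w \<sigma> * Ainf_const \<sigma> * weight_mass \<sigma> Q)"
proof -
  obtain C where C: "0 < C" and fin: "\<forall>(\<mu>::(real ^ 'n) measure) \<nu> F a A.
    sparse_laminar \<mu> \<nu> F c \<longrightarrow> 0 \<le> A \<longrightarrow>
    (\<forall>L\<in>F. 0 \<le> a L \<and> measure \<nu> L / measure \<mu> L * a L powr (p - 1) \<le> A) \<longrightarrow>
    (\<integral>\<^sup>+x. ennreal (tower a F x powr p) \<partial>\<nu>)
      \<le> ennreal (C * A * (\<Sum>L\<in>F. a L * measure \<mu> L))"
    using finite_testing[OF assms(2,1), where ?'a = "real ^ 'n"] by (elim exE conjE) (rule that)
  show ?thesis
  proof (intro exI conjI allI impI)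
    show "0 < C / c" using C assms by simp
    fix w \<sigma> :: "real ^ 'n \<Rightarrow> real" and \<L> :: "(real ^ 'n) set set" and Q :: "(real ^ 'n) set"
    assume w: "weight w" and \<sigma>: "weight \<sigma>" and sp: "sparse_family c \<L>" and Q: "Q \<in> dyadic_cubes"
    define \<G> where "\<G> = {L \<in> \<L>. L \<subseteq> Q}"
    define R where "R = ennreal (C / c) * Ap_const p w \<sigma> * Ainf_const \<sigma> * weight_mass \<sigma> Q"
    define a where "a = (\<lambda>L. measure (weight_measure \<sigma>) L / measure lebesgue L)"
    have dyadic: "\<G> \<subseteq> dyadic_cubes" using sp unfolding sparse_family_def \<G>_def by blast
    have cube: "Q \<in> cubes" "\<And>L. L \<in> \<G> \<Longrightarrow> L \<in> cubes" using Q dyadic dyadic_subset_cubes by blast+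
    have a_nonneg: "0 \<le> a L" for L by (simp add: a_def)
    have finite_subfamily: "(\<integral>\<^sup>+x. ennreal (tower a G x powr p) \<partial>weight_measure w) \<le> R"
      if G: "finite G" "G \<subseteq> \<G>" for G
    proof (cases "Ap_const p w \<sigma> = \<infinity>")
      case True
      have "R = \<infinity>"
        using C assms Ainf_const_nonzero[OF \<sigma> Q] weight_mass_nonzero[OF \<sigma> cube(1)]
        by (simp add: R_def True ennreal_mult_top ennreal_top_mult)
      then show ?thesis by simp
    next
      case False
      define A where "A = enn2real (Ap_const p w \<sigma>)"
      have A: "Ap_const p w \<sigma> = ennreal A" "0 \<le> A" using False by (auto simp: A_def less_top)
      have "sparse_laminar lebesgue (weight_measure w) G c"
        using G by (intro sparse_laminar_weight[OF w sp assms(2)]) (auto simp: \<G>_def)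
      moreover have "\<forall>L\<in>G. 0 \<le> a L \<and> measure (weight_measure w) L / measure lebesgue L * a L powr (p - 1) \<le> A"
        using avg_powr_le_Ap_const[OF w \<sigma> _ A] cube(2) G(2) a_nonneg unfolding a_def by blast
      ultimately have "(\<integral>\<^sup>+x. ennreal (tower a G x powr p) \<partial>weight_measure w)
          \<le> ennreal (C * A * (\<Sum>L\<in>G. a L * measure lebesgue L))"
        using fin A(2) by blast
      also have "(\<Sum>L\<in>G. a L * measure lebesgue L) = (\<Sum>L\<in>G. measure (weight_measure \<sigma>) L)"
      proof (intro sum.cong refl)
        fix L assume "L \<in> G"
        then have "0 < measure lebesgue L" using G(2) cube(2) measure_cube_pos by blast
        then show "a L * measure lebesgue L = measure (weight_measure \<sigma>) L" by (simp add: a_def)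
      qed
      also have "ennreal (C * A * (\<Sum>L\<in>G. measure (weight_measure \<sigma>) L))
          = ennreal (C / c) * ennreal A * (ennreal c * ennreal (\<Sum>L\<in>G. measure (weight_measure \<sigma>) L))"
        using C A(2) assms by (simp add: ennreal_mult[symmetric] sum_nonneg)
      also have "ennreal (\<Sum>L\<in>G. measure (weight_measure \<sigma>) L) = (\<Sum>L\<in>G. weight_mass \<sigma> L)"
        unfolding sum_ennreal[OF measure_nonneg, symmetric]
        using G(2) cube(2) by (intro sum.cong refl weight_mass_eq_measure[OF \<sigma>, symmetric]) blast
      also have "ennreal (C / c) * ennreal A * (ennreal c * (\<Sum>L\<in>G. weight_mass \<sigma> L))
          \<le> ennreal (C / c) * ennreal A * (Ainf_const \<sigma> * weight_mass \<sigma> Q)"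
        using carleson_weight_mass[OF \<sigma> sp cube(1) G[unfolded \<G>_def]] by (rule mult_left_mono) simp
      finally show ?thesis by (simp add: R_def A(1) mult.assoc)
    qed
    have "(\<integral>\<^sup>+x\<in>Q. ennreal_powr
          (\<Sum>\<^sub>\<infinity>L\<in>\<G>. cube_avg (\<lambda>y. ennreal (\<sigma> y)) L * indicator L x) p * ennreal (w x) \<partial>lebesgue)
        \<le> (\<integral>\<^sup>+x. ennreal_powr (\<Sum>\<^sub>\<infinity>L\<in>\<G>. ennreal (a L) * indicator L x) p * ennreal (w x) \<partial>lebesgue)"
    proof (intro nn_integral_mono)
      fix x
      have "(\<Sum>\<^sub>\<infinity>L\<in>\<G>. cube_avg (\<lambda>y. ennreal (\<sigma> y)) L * indicator L x)
          = (\<Sum>\<^sub>\<infinity>L\<in>\<G>. ennreal (a L) * indicator L x)"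
        using cube_avg_eq[OF \<sigma> cube(2)] by (intro infsum_cong) (simp add: a_def)
      then show "ennreal_powr (\<Sum>\<^sub>\<infinity>L\<in>\<G>. cube_avg (\<lambda>y. ennreal (\<sigma> y)) L * indicator L x) p
          * ennreal (w x) * indicator Q x
          \<le> ennreal_powr (\<Sum>\<^sub>\<infinity>L\<in>\<G>. ennreal (a L) * indicator L x) p * ennreal (w x)"
        by (simp add: indicator_def)
    qed
    also have "\<dots> \<le> R"
    proof (intro nn_integral_infsum_powr_le[OF w] finite_subfamily a_nonneg)
      show "countable \<G>" by (rule countable_subset[OF dyadic countable_dyadic_cubes])
      show "L \<in> sets lebesgue" if "L \<in> \<G>" for L using cube(2)[OF that] by (rule cubes_sets_lebesgue)
    qed (use assms in auto)
    finally show "(\<integral>\<^sup>+x\<in>Q. ennreal_powr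
            (\<Sum>\<^sub>\<infinity>L\<in>{L \<in> \<L>. L \<subseteq> Q}. cube_avg (\<lambda>y. ennreal (\<sigma> y)) L * indicator L x) p
          * ennreal (w x) \<partial>lebesgue)
       \<le> ennreal (C / c) * Ap_const p w \<sigma> * Ainf_const \<sigma> * weight_mass \<sigma> Q"
      unfolding \<G>_def R_def .
  qed
qed

end
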